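(* For integers $m\ge n\ge 2$, $$ub(K_{m,n})\le \min\left\{\left\lceil \frac m4\right\rceil+\frac{2m}{n}+12,\ \frac m4+n+1\right\}.$$ Consequently $ub(K_{m,n})\le \frac m4+o(m)$ as $m\to\infty$ (uniformly over $2\le n\le m$).
   Context: $K_{m,n}$ is the complete bipartite graph with parts of sizes $m$ and $n$. A bar is a closed horizontal line segment of length $1$ in the plane. Two bars of an arrangement of pairwise disjoint bars see each other if there is an axis-parallel rectangle of positive width whose bottom side lies in one of them, whose top side lies in the other, and whose interior meets no bar of the arrangement. For a nonnegative integer $t$, a $t$-unit-bar visibility representation of a graph $G$ assigns to each vertex a set of at most $t$ bars, all bars pairwise disjoint, such that two distinct vertices are adjacent iff some bar of one sees some bar of the other; $ub(G)$ is the minimum such $t$. *)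

theory Defs
  imports
    "HOL-Analysis.Analysis"
    "HOL-Library.Landau_Symbols"
    "Graph_Theory.Graph_Theory"
begin

definition is_bar :: "(real \<times> real) set \<Rightarrow> bool" where
  "is_bar B \<longleftrightarrow> (\<exists>x y. B = {x..x + 1} \<times> {y})"

definition sees :: "(real \<times> real) set set \<Rightarrow> (real \<times> real) set \<Rightarrow> (real \<times> real) set \<Rightarrow> bool" where
  "sees \<A> B C \<longleftrightarrow>
     (\<exists>a b c d. a < b \<and> c < d \<and>
        ({a..b} \<times> {c} \<subseteq> B \<and> {a..b} \<times> {d} \<subseteq> C \<or>
         {a..b} \<times> {c} \<subseteq> C \<and> {a..b} \<times> {d} \<subseteq> B) \<and>
        (\<forall>D\<in>\<A>. ({a<..<b} \<times> {c<..<d}) \<inter> D = {}))"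

text \<open>
  As in the Graph-Theory entry, a graph is a symmetric digraph (locale \<^locale>\<open>graph\<close>).
  Disjointness is required of the indexed family of bars: the same bar may not be assigned to two
  different vertices, which the plain pairwise disjointness of the union would not exclude.
\<close>

definition unit_bar_rep ::
  "nat \<Rightarrow> ('a, 'b) pre_digraph \<Rightarrow> ('a \<Rightarrow> (real \<times> real) set set) \<Rightarrow> bool" where
  "unit_bar_rep t G f \<longleftrightarrow>
     (\<forall>v\<in>verts G. finite (f v) \<and> card (f v) \<le> t \<and> (\<forall>B\<in>f v. is_bar B)) \<and>
     (\<forall>u\<in>verts G. \<forall>v\<in>verts G. \<forall>B\<in>f u. \<forall>C\<in>f v. (u, B) \<noteq> (v, C) \<longrightarrow> B \<inter> C = {}) \<and>
     (\<forall>u\<in>verts G. \<forall>v\<in>verts G. u \<noteq> v \<longrightarrow>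
        (u \<rightarrow>\<^bsub>G\<^esub> v \<longleftrightarrow> (\<exists>B\<in>f u. \<exists>C\<in>f v. sees (\<Union>w\<in>verts G. f w) B C)))"

definition ub :: "('a, 'b) pre_digraph \<Rightarrow> nat" where
  "ub G = (LEAST t. \<exists>f. unit_bar_rep t G f)"

text \<open>
  The minimum in \<^const>\<open>ub\<close> is attained for every graph: draw the two ends of each arc as two bars,
  one above the other, far away from all the other bars.
\<close>

lemma ex_unit_bar_rep:
  assumes "graph G"
  shows "\<exists>t f. unit_bar_rep t G f"
proof -
  interpret graph G by fact
  obtain i :: "'b \<Rightarrow> nat" where i: "inj_on i (arcs G)"
    using finite_imp_inj_to_nat_seg[OF finite_arcs] by blast
  define bar :: "'b \<Rightarrow> real \<Rightarrow> (real \<times> real) set"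
    where "bar e y = {2 * real (i e)..2 * real (i e) + 1} \<times> {y}" for e y
  define f where "f v = {bar e 0 |e. e \<in> arcs G \<and> tail G e = v} \<union>
    {bar e 1 |e. e \<in> arcs G \<and> head G e = v}" for v
  define t where "t = Max (insert 0 ((\<lambda>v. card (f v)) ` verts G))"
  have fE: "\<exists>e y. e \<in> arcs G \<and> B = bar e y \<and> (y = 0 \<and> v = tail G e \<or> y = 1 \<and> v = head G e)"
    if "B \<in> f v" for B v
    using that unfolding f_def by blast
  have far: "e = e'" if "e \<in> arcs G" "e' \<in> arcs G"
    "x \<in> {2 * real (i e)..2 * real (i e) + 1}" "x \<in> {2 * real (i e')..2 * real (i e') + 1}" for e e' x
  proof -
    have "real (i e) < real (i e') + 1" "real (i e') < real (i e) + 1"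
      using that(3,4) by auto
    then have "i e = i e'" by linarith
    with i that(1,2) show ?thesis by (auto dest: inj_onD)
  qed
  have fin: "finite (f v)" for v
  proof -
    have "f v \<subseteq> (\<lambda>e. bar e 0) ` arcs G \<union> (\<lambda>e. bar e 1) ` arcs G"
      unfolding f_def by blast
    then show ?thesis by (rule finite_subset) simp
  qed
  have c: "card (f v) \<le> t" if "v \<in> verts G" for v
    unfolding t_def by (rule Max_ge) (use that in auto)
  have b: "is_bar B" if "B \<in> f v" for B v
    using fE[OF that] unfolding is_bar_def bar_def by blast
  have d: "B \<inter> C = {}" if BC: "B \<in> f u" "C \<in> f v" "(u, B) \<noteq> (v, C)" for u v B C
  proof (rule ccontr)
    assume "B \<inter> C \<noteq> {}"
    then obtain x z where xz: "(x, z) \<in> B" "(x, z) \<in> C" by auto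
    obtain e y where e: "e \<in> arcs G" "B = bar e y" "y = 0 \<and> u = tail G e \<or> y = 1 \<and> u = head G e"
      using fE[OF BC(1)] by blast
    obtain e' y' where e': "e' \<in> arcs G" "C = bar e' y'"
      "y' = 0 \<and> v = tail G e' \<or> y' = 1 \<and> v = head G e'"
      using fE[OF BC(2)] by blast
    have "y = y'" "e = e'"
      using xz far[OF e(1) e'(1), of x] by (auto simp: e(2) e'(2) bar_def)
    with BC(3) e e' show False by auto
  qed
  have s1: "\<exists>B\<in>f u. \<exists>C\<in>f v. sees (\<Union>w\<in>verts G. f w) B C" if uv: "u \<rightarrow>\<^bsub>G\<^esub> v" for u v
  proof -
    from uv obtain e where e: "e \<in> arcs G" "tail G e = u" "head G e = v"
      by (auto simp: arcs_ends_conv)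
    have "bar e 0 \<in> f u" "bar e 1 \<in> f v" using e unfolding f_def by blast+
    moreover have "sees (\<Union>w\<in>verts G. f w) (bar e 0) (bar e 1)"
      unfolding sees_def
    proof (intro exI conjI ballI)
      fix D assume "D \<in> (\<Union>w\<in>verts G. f w)"
      then obtain e' y' where "D = bar e' y'" "y' = 0 \<or> y' = 1" using fE by blast
      then show "({2 * real (i e)<..<2 * real (i e) + 1} \<times> {0<..<1}) \<inter> D = {}"
        by (auto simp: bar_def)
    qed (auto simp: bar_def)
    ultimately show ?thesis by blast
  qed
  have s2: "u \<rightarrow>\<^bsub>G\<^esub> v" if uv: "u \<noteq> v" "B \<in> f u" "C \<in> f v" "sees \<A> B C" for u v B C \<A>
  proof -
    obtain e y where e: "e \<in> arcs G" "B = bar e y" "y = 0 \<and> u = tail G e \<or> y = 1 \<and> u = head G e"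
      using fE[OF uv(2)] by blast
    obtain e' y' where e': "e' \<in> arcs G" "C = bar e' y'"
      "y' = 0 \<and> v = tail G e' \<or> y' = 1 \<and> v = head G e'"
      using fE[OF uv(3)] by blast
    obtain a r p q where "a < r"
      "{a..r} \<times> {p} \<subseteq> B \<and> {a..r} \<times> {q} \<subseteq> C \<or> {a..r} \<times> {p} \<subseteq> C \<and> {a..r} \<times> {q} \<subseteq> B"
      using uv(4) unfolding sees_def by blast
    then have "(\<exists>y. (a, y) \<in> B) \<and> (\<exists>y. (a, y) \<in> C)" by fastforce
    then have "e = e'" using far[OF e(1) e'(1), of a] by (auto simp: e(2) e'(2) bar_def)
    then have "u = tail G e \<and> v = head G e \<or> v = tail G e \<and> u = head G e"
      using e e' uv(1) by auto
    moreover have "tail G e \<rightarrow>\<^bsub>G\<^esub> head G e" using e(1) by (auto simp: arcs_ends_conv)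
    ultimately show ?thesis using sym_arcs by (auto simp: symmetric_def dest: symD)
  qed
  have "unit_bar_rep t G f"
    unfolding unit_bar_rep_def
    by (intro conjI ballI impI iffI; (elim bexE)?) (rule fin c b d s1 s2; assumption)+
  then show ?thesis by blast
qed

end

theory Submission
  imports Defs
begin

text \<open>
  Let \<open>U\<close> and \<open>V\<close> be the parts of sizes \<open>m\<close> and \<open>n\<close>. Bars are arranged in horizontal rows of
  abutting bars that alternate between \<open>U\<close> and \<open>V\<close>, so that it suffices to
  separate any two rows of the same part by a row of the other part.

  For even \<open>n\<close>, each row for \<open>V\<close> alternates between two vertices and has about \<open>m / 2\<close> bars. The rows
  are shifted by half a bar each, so that a bar between two such rows sees all four vertices
  on them. Rows for \<open>U\<close> carry in turn the first and the second half of \<open>U\<close>, hence every row for \<open>V\<close>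
  meets one half above and the other half below it. This takes about \<open>m / 4\<close> bars per vertex of \<open>V\<close>
  and \<open>n / 4\<close> bars per vertex of \<open>U\<close>.

  For odd \<open>n\<close>, three vertices of \<open>V\<close> are treated separately, in a drawing in which almost every bar of
  \<open>U\<close> sees exactly these three vertices and almost every bar of \<open>V\<close> sees four bars of \<open>U\<close>. In total
  \<open>m / 4 + min 5 (n + 1)\<close> bars per vertex suffice.
\<close>

section \<open>Labelled drawings and their bound on \<open>ub\<close>\<close>

definition bar :: "real \<Rightarrow> real \<Rightarrow> (real \<times> real) set" where
  "bar x y = {x..x + 1} \<times> {y}"

text \<open>
  A triple \<open>(v, x, y)\<close> is a bar of the vertex \<open>v\<close> with left end \<open>(x, y)\<close>. The second condition on \<open>drawing\<close>
  blocks every vertical line of sight between two vertices of the same part; sight between two bars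
  of the same vertex is harmless.
\<close>

definition drawing :: "'a set \<Rightarrow> 'a set \<Rightarrow> ('a \<times> real \<times> real) set \<Rightarrow> bool" where
  "drawing U V S \<longleftrightarrow> finite S \<and> fst ` S \<subseteq> U \<union> V \<and>
     (\<forall>v x w x' y. (v, x, y) \<in> S \<longrightarrow> (w, x', y) \<in> S \<longrightarrow> \<bar>x - x'\<bar> \<le> 1 \<longrightarrow> v = w \<and> x = x') \<and>
     (\<forall>v x y w x' y' z. (v, x, y) \<in> S \<longrightarrow> (w, x', y') \<in> S \<longrightarrow> y < y' \<longrightarrow> v \<noteq> w \<longrightarrow>
        (v \<in> U \<longleftrightarrow> w \<in> U) \<longrightarrow> x < z \<longrightarrow> z < x + 1 \<longrightarrow> x' < z \<longrightarrow> z < x' + 1 \<longrightarrow>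
        (\<exists>k p q. (k, p, q) \<in> S \<and> y < q \<and> q < y' \<and> p \<le> z \<and> z \<le> p + 1)) \<and>
     (\<forall>u\<in>U. \<forall>v\<in>V. \<exists>x y x' y' a b. (u, x, y) \<in> S \<and> (v, x', y') \<in> S \<and> y \<noteq> y' \<and> a < b \<and>
        x \<le> a \<and> b \<le> x + 1 \<and> x' \<le> a \<and> b \<le> x' + 1 \<and>
        (\<forall>k p q. (k, p, q) \<in> S \<longrightarrow> min y y' < q \<longrightarrow> q < max y y' \<longrightarrow> b \<le> p \<or> p + 1 \<le> a))"

definition copies :: "('a \<times> real \<times> real) set \<Rightarrow> 'a \<Rightarrow> nat" where
  "copies S v = card {p \<in> S. fst p = v}"

lemma segment_subset_bar:
  assumes "a < b"
  shows "{a..b} \<times> {c} \<subseteq> bar x y \<longleftrightarrow> c = y \<and> x \<le> a \<and> b \<le> x + 1"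
  using assms by (auto simp: bar_def subset_iff)

lemma sees_barI:
  assumes "y \<noteq> y'" "a < b" "x \<le> a" "b \<le> x + 1" "x' \<le> a" "b \<le> x' + 1"
    and "\<And>D. D \<in> \<A> \<Longrightarrow> ({a<..<b} \<times> {min y y'<..<max y y'}) \<inter> D = {}"
  shows "sees \<A> (bar x y) (bar x' y')"
  unfolding sees_def
  by (rule exI[of _ a], rule exI[of _ b], rule exI[of _ "min y y'"], rule exI[of _ "max y y'"])
    (use assms in \<open>auto simp: segment_subset_bar min_def max_def\<close>)

lemma sees_barE:
  assumes "sees \<A> (bar x y) (bar x' y')"
  obtains a b where "y \<noteq> y'" "a < b" "x \<le> a" "b \<le> x + 1" "x' \<le> a" "b \<le> x' + 1"
    and "\<And>D. D \<in> \<A> \<Longrightarrow> ({a<..<b} \<times> {min y y'<..<max y y'}) \<inter> D = {}"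
proof -
  from assms obtain a b c d where ab: "a < b" "c < d" and
    s: "{a..b} \<times> {c} \<subseteq> bar x y \<and> {a..b} \<times> {d} \<subseteq> bar x' y' \<or>
      {a..b} \<times> {c} \<subseteq> bar x' y' \<and> {a..b} \<times> {d} \<subseteq> bar x y"
    and D: "\<forall>D\<in>\<A>. ({a<..<b} \<times> {c<..<d}) \<inter> D = {}"
    unfolding sees_def by blast
  from s ab have "c = min y y'" "d = max y y'" "x \<le> a" "b \<le> x + 1" "x' \<le> a" "b \<le> x' + 1"
    by (auto simp: segment_subset_bar)
  with ab D show ?thesis by (intro that[of a b]) auto
qed

text \<open>A rectangle of sight between two vertices of one part would contain a vertical segment
  that a bar strictly in between blocks; the free strip in the last clause of \<open>drawing\<close>
  is a rectangle of sight for each pair in \<open>U \<times> V\<close>.\<close>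

lemma ub_le_drawing:
  assumes G: "verts G = U \<union> V" "U \<inter> V = {}" "arcs_ends G = U \<times> V \<union> V \<times> U"
    and S: "drawing U V S" and t: "\<And>v. v \<in> U \<union> V \<Longrightarrow> copies S v \<le> t"
  shows "ub G \<le> t"
proof -
  define f where "f v = (\<lambda>p. bar (fst (snd p)) (snd (snd p))) ` {p \<in> S. fst p = v}" for v
  have fin: "finite S" and lab: "fst ` S \<subseteq> U \<union> V" using S by (auto simp: drawing_def)
  have fI: "bar x y \<in> f v" if "(v, x, y) \<in> S" for v x y
    unfolding f_def by (rule image_eqI[of _ _ "(v, x, y)"]) (use that in auto)
  have fE: "\<exists>x y. (v, x, y) \<in> S \<and> B = bar x y" if "B \<in> f v" for v B
    using that unfolding f_def by force
  have legal: "(u \<in> U) \<noteq> (v \<in> U)"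
    if uv: "u \<noteq> v" "(u, x, y) \<in> S" "(v, x', y') \<in> S"
      "sees (\<Union>w\<in>verts G. f w) (bar x y) (bar x' y')" for u v x y x' y'
  proof
    assume eq: "(u \<in> U) = (v \<in> U)"
    obtain a b where ab: "y \<noteq> y'" "a < b" "x \<le> a" "b \<le> x + 1" "x' \<le> a" "b \<le> x' + 1"
      and D: "\<And>D. D \<in> (\<Union>w\<in>verts G. f w) \<Longrightarrow> ({a<..<b} \<times> {min y y'<..<max y y'}) \<inter> D = {}"
      using uv(4) by (rule sees_barE) blast
    \<comment> \<open>The midpoint is interior to both bars, as the blocking clause demands, and to
      the rectangle, so even a blocking bar that touches \<open>z\<close> only with an endpoint
      meets the open rectangle.\<close>
    define z where "z = (a + b) / 2"
    have z: "a < z" "z < b" "x < z" "z < x + 1" "x' < z" "z < x' + 1"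
      using ab by (auto simp: z_def)
    have block: "\<exists>k p q. (k, p, q) \<in> S \<and> s < q \<and> q < s' \<and> p \<le> z \<and> z \<le> p + 1"
      if "(i, r, s) \<in> S" "(j, r', s') \<in> S" "s < s'" "i \<noteq> j" "(i \<in> U) = (j \<in> U)"
        "r < z" "z < r + 1" "r' < z" "z < r' + 1" for i j r s r' s'
      using S that unfolding drawing_def by blast
    have "\<exists>k p q. (k, p, q) \<in> S \<and> min y y' < q \<and> q < max y y' \<and> p \<le> z \<and> z \<le> p + 1"
    proof (cases "y < y'")
      case True
      then show ?thesis using block[OF uv(2,3)] uv(1) eq z by simp
    next
      case False
      with ab(1) show ?thesis using block[OF uv(3,2)] uv(1) eq z by simp
    qed
    then obtain k p q where k: "(k, p, q) \<in> S" "min y y' < q" "q < max y y'" "p \<le> z" "z \<le> p + 1"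
      by blast
    have "bar p q \<in> (\<Union>w\<in>verts G. f w)"
      using fI[OF k(1)] k(1) lab G(1) by force
    moreover have "(z, q) \<in> ({a<..<b} \<times> {min y y'<..<max y y'}) \<inter> bar p q"
      using k z by (auto simp: bar_def)
    ultimately show False using D by blast
  qed
  \<comment> \<open>Both orders are recorded because each edge is an arc in both directions.\<close>
  have cover: "\<exists>B\<in>f u. \<exists>C\<in>f v. sees (\<Union>w\<in>verts G. f w) B C \<and> sees (\<Union>w\<in>verts G. f w) C B"
    if uv: "u \<in> U" "v \<in> V" for u v
  proof -
    from S uv obtain x y x' y' a b where *: "(u, x, y) \<in> S" "(v, x', y') \<in> S" "y \<noteq> y'" "a < b"
      "x \<le> a" "b \<le> x + 1" "x' \<le> a" "b \<le> x' + 1"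
      and free: "\<And>k p q. (k, p, q) \<in> S \<Longrightarrow> min y y' < q \<Longrightarrow> q < max y y' \<Longrightarrow> b \<le> p \<or> p + 1 \<le> a"
      unfolding drawing_def by (elim conjE) (drule (1) bspec, drule (1) bspec, blast)
    have D: "({a<..<b} \<times> {min y y'<..<max y y'}) \<inter> D = {}" if D: "D \<in> (\<Union>w\<in>verts G. f w)" for D
    proof -
      from D fE obtain k p q where k: "(k, p, q) \<in> S" "D = bar p q" by blast
      show ?thesis using free[OF k(1)] unfolding k(2) bar_def by fastforce
    qed
    have "sees (\<Union>w\<in>verts G. f w) (bar x y) (bar x' y')"
      by (rule sees_barI[of y y' a b]) (use * D in auto)
    moreover have "sees (\<Union>w\<in>verts G. f w) (bar x' y') (bar x y)"
      by (rule sees_barI[of y' y a b]) (use * D in \<open>auto simp: min.commute max.commute\<close>)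
    ultimately show ?thesis using fI[OF *(1)] fI[OF *(2)] by blast
  qed
  have "unit_bar_rep t G f"
    unfolding unit_bar_rep_def
  proof (intro conjI ballI impI)
    fix v assume v: "v \<in> verts G"
    show "finite (f v)" using fin by (simp add: f_def)
    have "card (f v) \<le> copies S v"
      unfolding f_def copies_def using fin by (intro card_image_le) auto
    with t[of v] v G(1) show "card (f v) \<le> t" by simp
    fix B assume "B \<in> f v" then show "is_bar B" using fE unfolding is_bar_def bar_def by blast
  next
    fix u v B C assume *: "B \<in> f u" "C \<in> f v" "(u, B) \<noteq> (v, C)"
    obtain x y where B: "(u, x, y) \<in> S" "B = bar x y" using fE *(1) by blast
    obtain x' y' where C: "(v, x', y') \<in> S" "C = bar x' y'" using fE *(2) by blast
    show "B \<inter> C = {}"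
    proof (rule ccontr)
      assume "B \<inter> C \<noteq> {}"
      then have "y = y'" "\<bar>x - x'\<bar> \<le> 1" by (auto simp: B C bar_def)
      with S B(1) C(1) have "u = v" "x = x'" unfolding drawing_def by blast+
      with \<open>y = y'\<close> * B C show False by simp
    qed
  next
    fix u v assume uv: "u \<in> verts G" "v \<in> verts G" "u \<noteq> v"
    show "u \<rightarrow>\<^bsub>G\<^esub> v \<longleftrightarrow> (\<exists>B\<in>f u. \<exists>C\<in>f v. sees (\<Union>w\<in>verts G. f w) B C)"
    proof
      assume "u \<rightarrow>\<^bsub>G\<^esub> v"
      then have "u \<in> U \<and> v \<in> V \<or> v \<in> U \<and> u \<in> V" using G(3) by auto
      then show "\<exists>B\<in>f u. \<exists>C\<in>f v. sees (\<Union>w\<in>verts G. f w) B C" using cover by blast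
    next
      assume "\<exists>B\<in>f u. \<exists>C\<in>f v. sees (\<Union>w\<in>verts G. f w) B C"
      then have "(u \<in> U) \<noteq> (v \<in> U)" using legal[OF uv(3)] fE by metis
      then show "u \<rightarrow>\<^bsub>G\<^esub> v" using uv G by auto
    qed
  qed
  then show ?thesis unfolding ub_def by (intro Least_le) blast
qed

section \<open>Combining drawings and building them from rows\<close>

text \<open>The second drawing is translated so far to the right that no vertical line meets both,
  so neither sight nor blocking passes between them. Only vertices with bars in both, in particular
  those of \<open>U\<close>, pay twice.\<close>

lemma drawing_union:
  assumes S: "drawing U V S" and T: "drawing U W T" and disj: "U \<inter> V = {}" "U \<inter> W = {}"
  shows "\<exists>R. drawing U (V \<union> W) R \<and> (\<forall>v. copies R v \<le> copies S v + copies T v)"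
proof -
  have fin: "finite S" "finite T" using S T by (auto simp: drawing_def)
  obtain X where X: "\<And>v x y. (v, x, y) \<in> S \<Longrightarrow> x \<le> X"
  proof -
    have "bdd_above ((\<lambda>p. fst (snd p)) ` S)" using fin by simp
    then show ?thesis using that by (force simp: bdd_above_def)
  qed
  obtain Y where Y: "\<And>v x y. (v, x, y) \<in> T \<Longrightarrow> Y \<le> x"
  proof -
    have "bdd_below ((\<lambda>p. fst (snd p)) ` T)" using fin by simp
    then show ?thesis using that by (force simp: bdd_below_def)
  qed
  \<comment> \<open>\<open>X\<close> bounds the left ends of \<open>S\<close> from above and
    \<open>Y\<close> those of \<open>T\<close> from below, so left ends in the two drawings end up
    at least 2 apart.\<close>
  define c where "c = X - Y + 2"
  define T' where "T' = (\<lambda>(v, x, y). (v, x + c, y)) ` T"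
  have memT: "(v, x, y) \<in> T' \<longleftrightarrow> (v, x - c, y) \<in> T" for v x y
    by (force simp: T'_def)
  have far: "x + 2 \<le> x'" if "(v, x, y) \<in> S" "(w, x', y') \<in> T'" for v x y w x' y'
    using X[OF that(1)] Y[of w "x' - c" y'] that(2) by (simp add: memT c_def)
  have *: "fst ` S \<subseteq> U \<union> V" "fst ` T \<subseteq> U \<union> W" using S T by (simp_all add: drawing_def)
  then have labS: "v \<in> U \<union> V" if "(v, x, y) \<in> S" for v x y
    using that by force
  from * have labT: "v \<in> U \<union> W" if "(v, x, y) \<in> T" for v x y
    using that by force
  define R where "R = S \<union> T'"
  have "drawing U (V \<union> W) R"
    unfolding drawing_def
  proof (intro conjI allI impI ballI)
    show "finite R" using fin by (simp add: R_def T'_def)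
    show "fst ` R \<subseteq> U \<union> (V \<union> W)" using labS labT by (force simp: R_def memT)
    fix v x w x' y assume *: "(v, x, y) \<in> R" "(w, x', y) \<in> R" "\<bar>x - x'\<bar> \<le> 1"
    have "(v, x, y) \<in> S \<and> (w, x', y) \<in> S \<or> (v, x - c, y) \<in> T \<and> (w, x' - c, y) \<in> T"
      using * far by (force simp: R_def memT)
    moreover have "v = w \<and> x = x'" if "(v, x, y) \<in> S" "(w, x', y) \<in> S"
      using S that *(3) unfolding drawing_def by blast
    moreover have "v = w \<and> x - c = x' - c" if "(v, x - c, y) \<in> T" "(w, x' - c, y) \<in> T"
    proof -
      have "\<bar>(x - c) - (x' - c)\<bar> \<le> 1" using *(3) by simp
      with T that show ?thesis unfolding drawing_def by blast
    qed
    ultimately show "v = w" "x = x'" by auto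
  next
    fix v x y w x' y' z
    assume *: "(v, x, y) \<in> R" "(w, x', y') \<in> R" "y < y'" "v \<noteq> w" "(v \<in> U) = (w \<in> U)"
      "x < z" "z < x + 1" "x' < z" "z < x' + 1"
    have "(v, x, y) \<in> S \<and> (w, x', y') \<in> S \<or> (v, x - c, y) \<in> T \<and> (w, x' - c, y') \<in> T"
      using * far by (force simp: R_def memT)
    then show "\<exists>k p q. (k, p, q) \<in> R \<and> y < q \<and> q < y' \<and> p \<le> z \<and> z \<le> p + 1"
    proof
      assume "(v, x, y) \<in> S \<and> (w, x', y') \<in> S"
      then have "\<exists>k p q. (k, p, q) \<in> S \<and> y < q \<and> q < y' \<and> p \<le> z \<and> z \<le> p + 1"
        using S * unfolding drawing_def by blast
      then show ?thesis by (auto simp: R_def)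
    next
      assume T2: "(v, x - c, y) \<in> T \<and> (w, x' - c, y') \<in> T"
      have "x - c < z - c" "z - c < x - c + 1" "x' - c < z - c" "z - c < x' - c + 1"
        using * by auto
      then have "\<exists>k p q. (k, p, q) \<in> T \<and> y < q \<and> q < y' \<and> p \<le> z - c \<and> z - c \<le> p + 1"
        using T T2 *(3-5) unfolding drawing_def by blast
      then obtain k p q where "(k, p, q) \<in> T" "y < q" "q < y'" "p \<le> z - c" "z - c \<le> p + 1"
        by blast
      then show ?thesis
        by (intro exI[of _ k] exI[of _ "p + c"] exI[of _ q]) (auto simp: R_def memT)
    qed
  next
    fix u v assume u: "u \<in> U" and "v \<in> V \<union> W"
    then consider "v \<in> V" | "v \<in> W" by blast
    then show "\<exists>x y x' y' a b. (u, x, y) \<in> R \<and> (v, x', y') \<in> R \<and> y \<noteq> y' \<and> a < b \<and>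
        x \<le> a \<and> b \<le> x + 1 \<and> x' \<le> a \<and> b \<le> x' + 1 \<and>
        (\<forall>k p q. (k, p, q) \<in> R \<longrightarrow> min y y' < q \<longrightarrow> q < max y y' \<longrightarrow> b \<le> p \<or> p + 1 \<le> a)"
    proof cases
      case 1
      with S u obtain x y x' y' a b where *: "(u, x, y) \<in> S" "(v, x', y') \<in> S" "y \<noteq> y'" "a < b"
        "x \<le> a" "b \<le> x + 1" "x' \<le> a" "b \<le> x' + 1"
        and free: "\<And>k p q. (k, p, q) \<in> S \<Longrightarrow> min y y' < q \<Longrightarrow> q < max y y' \<Longrightarrow> b \<le> p \<or> p + 1 \<le> a"
        unfolding drawing_def by (elim conjE) (drule (1) bspec, drule (1) bspec, blast)
      show ?thesis
      proof (intro exI conjI allI impI)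
        fix k p q assume "(k, p, q) \<in> R" "min y y' < q" "q < max y y'"
        then show "b \<le> p \<or> p + 1 \<le> a" using free far[OF *(1)] *(6) by (fastforce simp: R_def)
      next
        show "(u, x, y) \<in> R" "(v, x', y') \<in> R" using * by (auto simp: R_def)
      qed (use * in auto)
    next
      case 2
      with T u obtain x y x' y' a b where *: "(u, x, y) \<in> T" "(v, x', y') \<in> T" "y \<noteq> y'" "a < b"
        "x \<le> a" "b \<le> x + 1" "x' \<le> a" "b \<le> x' + 1"
        and free: "\<And>k p q. (k, p, q) \<in> T \<Longrightarrow> min y y' < q \<Longrightarrow> q < max y y' \<Longrightarrow> b \<le> p \<or> p + 1 \<le> a"
        unfolding drawing_def by (elim conjE) (drule (1) bspec, drule (1) bspec, blast)
      have uT: "(u, x + c, y) \<in> T'" using *(1) by (simp add: memT)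
      show ?thesis
      proof (intro exI conjI allI impI)
        fix k p q assume k: "(k, p, q) \<in> R" "min y y' < q" "q < max y y'"
        then consider "(k, p, q) \<in> S" | "(k, p - c, q) \<in> T" by (auto simp: R_def memT)
        then show "b + c \<le> p \<or> p + 1 \<le> a + c"
        proof cases
          case 1
          then show ?thesis using far[OF 1 uT] *(5) by simp
        next
          case 2
          then show ?thesis using free[OF 2 k(2,3)] by auto
        qed
      next
        show "(u, x + c, y) \<in> R" "(v, x' + c, y') \<in> R" using * by (auto simp: R_def memT)
      qed (use * in auto)
    qed
  qed
  moreover have "copies R v \<le> copies S v + copies T v" for v
  proof -
    have "{p \<in> R. fst p = v} = {p \<in> S. fst p = v} \<union> (\<lambda>(v, x, y). (v, x + c, y)) ` {p \<in> T. fst p = v}"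
      unfolding R_def T'_def by force
    also have "card \<dots> \<le> copies S v + card ((\<lambda>(v, x, y). (v, x + c, y)) ` {p \<in> T. fst p = v})"
      unfolding copies_def by (rule card_Un_le)
    also have "\<dots> \<le> copies S v + copies T v"
      unfolding copies_def using fin by (intro add_left_mono card_image_le) auto
    finally show ?thesis by (simp add: copies_def)
  qed
  ultimately show ?thesis by blast
qed

text \<open>This reduces a drawing to row-wise data: rows alternate between the parts, bars within a
  row may abut, and only pairs of rows of equal parity need blocking.\<close>

lemma drawing_rows:
  fixes x :: "nat \<Rightarrow> nat \<Rightarrow> real"
  assumes disj: "U \<inter> V = {}"
    and lab: "\<And>r i. r < R \<Longrightarrow> i < len r \<Longrightarrow> lab r i \<in> (if even r then U else V)"
    and step: "\<And>r i j. i < j \<Longrightarrow> x r i + 1 \<le> x r j"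
    and block: "\<And>r r' i j z. r < r' \<Longrightarrow> r' < R \<Longrightarrow> even r = even r' \<Longrightarrow> i < len r \<Longrightarrow> j < len r' \<Longrightarrow>
      x r i < z \<Longrightarrow> z < x r i + 1 \<Longrightarrow> x r' j < z \<Longrightarrow> z < x r' j + 1 \<Longrightarrow>
      \<exists>q k. r < q \<and> q < r' \<and> k < len q \<and> x q k \<le> z \<and> z \<le> x q k + 1"
    and cover: "\<And>u v. u \<in> U \<Longrightarrow> v \<in> V \<Longrightarrow> \<exists>r i r' j a b. r < r' \<and> r' < R \<and> i < len r \<and> j < len r' \<and>
      (lab r i = u \<and> lab r' j = v \<or> lab r i = v \<and> lab r' j = u) \<and> a < b \<and>
      x r i \<le> a \<and> b \<le> x r i + 1 \<and> x r' j \<le> a \<and> b \<le> x r' j + 1 \<and>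
      (\<forall>q k. r < q \<longrightarrow> q < r' \<longrightarrow> k < len q \<longrightarrow> b \<le> x q k \<or> x q k + 1 \<le> a)"
  shows "\<exists>S. drawing U V S \<and> (\<forall>v. copies S v \<le> card {(r, i). r < R \<and> i < len r \<and> lab r i = v})"
proof -
  \<comment> \<open>Abutting bars of a row share an endpoint unless they lie at different heights.\<close>
  define h :: "nat \<Rightarrow> nat \<Rightarrow> real" where "h r i = real r + real (i mod 2) / 2" for r i
  have h: "real r \<le> h r i" "h r i \<le> real r + 1 / 2" for r i
    unfolding h_def by auto
  \<comment> \<open>Offsets inside a row are at most \<open>1 / 2\<close>, so the perturbation
    cannot reorder the rows.\<close>
  have h_row: "r \<le> r'" if "h r i \<le> h r' j" for r r' i j
    using h(1)[of r i] h(2)[of r' j] that by linarith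
  have h_less: "h r i < h r' j" if "r < r'" for r r' i j
    using h_row[of r' j r i] that by fastforce
  define I where "I = Sigma {..<R} (\<lambda>r. {..<len r})"
  define g where "g = (\<lambda>(r, i). (lab r i, x r i, h r i))"
  define S where "S = g ` I"
  have SI: "(lab r i, x r i, h r i) \<in> S" if "r < R" "i < len r" for r i
    unfolding S_def g_def I_def by (rule image_eqI[of _ _ "(r, i)"]) (use that in auto)
  have SE: "\<exists>r i. r < R \<and> i < len r \<and> v = lab r i \<and> p = x r i \<and> q = h r i" if "(v, p, q) \<in> S" for v p q
    using that by (auto simp: S_def g_def I_def)
  have fin: "finite I" by (simp add: I_def)
  have "drawing U V S"
    unfolding drawing_def
  proof (intro conjI allI impI ballI)
    show "finite S" using fin by (simp add: S_def)
    show "fst ` S \<subseteq> U \<union> V" using lab by (force simp: S_def g_def I_def split: if_splits)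
    fix v p w p' y assume *: "(v, p, y) \<in> S" "(w, p', y) \<in> S" "\<bar>p - p'\<bar> \<le> 1"
    obtain r i where ri: "r < R" "i < len r" "v = lab r i" "p = x r i" "y = h r i"
      using SE[OF *(1)] by blast
    obtain r' j where rj: "r' < R" "j < len r'" "w = lab r' j" "p' = x r' j" "y = h r' j"
      using SE[OF *(2)] by blast
    have eq: "r = r'" using h_row[of r i r' j] h_row[of r' j r i] ri rj by simp
    with ri(5) rj(5) have par: "i mod 2 = j mod 2" by (simp add: h_def)
    \<comment> \<open>Equal heights within a row force positions of equal parity, and these leave a
      whole bar between them.\<close>
    have apart: "\<not> \<bar>x r k - x r l\<bar> \<le> 1" if "k < l" "k mod 2 = l mod 2" for k l
    proof -
      from that have "k + 1 < l" by presburger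
      then have "x r k + 1 \<le> x r (k + 1)" "x r (k + 1) + 1 \<le> x r l" by (auto intro: step)
      then show ?thesis by simp
    qed
    have "i = j"
      using apart[of i j] apart[of j i] par *(3) ri(4) rj(4) eq
      by (metis abs_minus_commute linorder_neqE_nat)
    then show "v = w" "p = p'" using eq ri rj by auto
  next
    fix v p y w p' y' z
    assume *: "(v, p, y) \<in> S" "(w, p', y') \<in> S" "y < y'" "v \<noteq> w" "(v \<in> U) = (w \<in> U)"
      "p < z" "z < p + 1" "p' < z" "z < p' + 1"
    obtain r i where ri: "r < R" "i < len r" "v = lab r i" "p = x r i" "y = h r i"
      using SE[OF *(1)] by blast
    obtain r' j where rj: "r' < R" "j < len r'" "w = lab r' j" "p' = x r' j" "y' = h r' j"
      using SE[OF *(2)] by blast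
    have "r \<le> r'" using h_row[of r i r' j] *(3) ri rj by simp
    moreover have "r \<noteq> r'"
    proof
      assume eq: "r = r'"
      have "i = j"
        using step[of i j r] step[of j i r] * ri rj eq by (cases i j rule: linorder_cases) auto
      with eq *(4) ri rj show False by simp
    qed
    ultimately have less: "r < r'" by simp
    have "even r = even r'"
      using lab[OF ri(1,2)] lab[OF rj(1,2)] *(5) ri(3) rj(3) disj by (auto split: if_splits)
    from block[OF less rj(1) this ri(2) rj(2)] * ri rj obtain q k
      where q: "r < q" "q < r'" "k < len q" "x q k \<le> z" "z \<le> x q k + 1" by blast
    show "\<exists>k p q. (k, p, q) \<in> S \<and> y < q \<and> q < y' \<and> p \<le> z \<and> z \<le> p + 1"
      using SI[of q k] q rj(1) h_less[OF q(1), of i k] h_less[OF q(2), of k j] ri(5) rj(5)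
      by (meson less_trans)
  next
    fix u v assume "u \<in> U" "v \<in> V"
    then obtain r i r' j a b where *: "r < r'" "r' < R" "i < len r" "j < len r'"
      "lab r i = u \<and> lab r' j = v \<or> lab r i = v \<and> lab r' j = u" "a < b"
      "x r i \<le> a" "b \<le> x r i + 1" "x r' j \<le> a" "b \<le> x r' j + 1"
      and free: "\<And>q k. r < q \<Longrightarrow> q < r' \<Longrightarrow> k < len q \<Longrightarrow> b \<le> x q k \<or> x q k + 1 \<le> a"
      using cover[of u v] by blast
    have S2: "(lab r i, x r i, h r i) \<in> S" "(lab r' j, x r' j, h r' j) \<in> S"
      using SI * by auto
    have lt: "h r i < h r' j" using h_less * by blast
    have clear: "b \<le> p \<or> p + 1 \<le> a" if k: "(k, p, q) \<in> S" "h r i < q" "q < h r' j" for k p q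
    proof -
      obtain s l where s: "s < R" "l < len s" "p = x s l" "q = h s l" using SE[OF k(1)] by blast
      have "r \<le> s" "s \<le> r'" using h_row[of r i s l] h_row[of s l r' j] k s by auto
      \<comment> \<open>Because of the perturbation, other bars of the rows \<open>r\<close> and
        \<open>r'\<close> can themselves lie strictly between the two heights; \<open>step\<close>
        keeps them out of the strip.\<close>
      then consider "s = r" | "s = r'" | "r < s" "s < r'" by linarith
      then show ?thesis
      proof cases
        case 1
        then have "l \<noteq> i" using k s by auto
        then show ?thesis using step[of l i r] step[of i l r] * s 1
          by (cases l i rule: linorder_cases) auto
      next
        case 2
        then have "l \<noteq> j" using k s by auto
        then show ?thesis using step[of l j r'] step[of j l r'] * s 2
          by (cases l j rule: linorder_cases) auto
      next
        case 3
        then show ?thesis using free s by blast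
      qed
    qed
    \<comment> \<open>A name for the cover clause with its two vertices as parameters, since either
      \<open>u\<close> or \<open>v\<close> may lie on the lower row.\<close>
    define Q where "Q = (\<lambda>u v p y p' y' a b. (u, p, y) \<in> S \<and> (v, p', y') \<in> S \<and> y \<noteq> y' \<and> a < b \<and>
        p \<le> a \<and> b \<le> p + 1 \<and> p' \<le> a \<and> b \<le> p' + 1 \<and>
        (\<forall>k p q. (k, p, q) \<in> S \<longrightarrow> min y y' < q \<longrightarrow> q < max y y' \<longrightarrow> b \<le> p \<or> p + 1 \<le> a))"
    have "Q (lab r i) (lab r' j) (x r i) (h r i) (x r' j) (h r' j) a b"
      "Q (lab r' j) (lab r i) (x r' j) (h r' j) (x r i) (h r i) a b"
      unfolding Q_def using * S2 lt clear by auto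
    then have "\<exists>p y p' y' a b. Q u v p y p' y' a b" using *(5) by metis
    then show "\<exists>p y p' y' a b. (u, p, y) \<in> S \<and> (v, p', y') \<in> S \<and> y \<noteq> y' \<and> a < b \<and>
        p \<le> a \<and> b \<le> p + 1 \<and> p' \<le> a \<and> b \<le> p' + 1 \<and>
        (\<forall>k p q. (k, p, q) \<in> S \<longrightarrow> min y y' < q \<longrightarrow> q < max y y' \<longrightarrow> b \<le> p \<or> p + 1 \<le> a)"
      unfolding Q_def .
  qed
  moreover have "copies S v \<le> card {(r, i). r < R \<and> i < len r \<and> lab r i = v}" for v
  proof -
    have eq: "{p \<in> S. fst p = v} = g ` {(r, i). r < R \<and> i < len r \<and> lab r i = v}"
      by (auto simp: S_def g_def I_def image_iff)
    have "finite {(r, i). r < R \<and> i < len r \<and> lab r i = v}"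
      by (rule finite_subset[OF _ fin]) (auto simp: I_def)
    then show ?thesis unfolding copies_def eq by (intro card_image_le)
  qed
  ultimately show ?thesis by blast
qed

section \<open>Counting in residue classes\<close>

text \<open>Within a residue class the quotient by \<open>M\<close> determines the number; the bound
  is \<open>K / M\<close> rounded up.\<close>

lemma card_residue_le:
  fixes K M a :: nat
  assumes "0 < M"
  shows "card {i. i < K \<and> i mod M = a} \<le> (K + M - 1) div M"
proof -
  have "inj_on (\<lambda>i. i div M) {i. i < K \<and> i mod M = a}"
    by (rule inj_onI) (metis (mono_tags, lifting) div_mult_mod_eq mem_Collect_eq)
  moreover have "(\<lambda>i. i div M) ` {i. i < K \<and> i mod M = a} \<subseteq> {..<(K + M - 1) div M}"
  proof (rule image_subsetI)
    fix i assume "i \<in> {i. i < K \<and> i mod M = a}"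
    then have "i + M \<le> K + M - 1" using assms by auto
    then have "(i + M) div M \<le> (K + M - 1) div M" by (rule div_le_mono)
    then show "i div M \<in> {..<(K + M - 1) div M}" using assms by simp
  qed
  ultimately have "card {i. i < K \<and> i mod M = a} \<le> card {..<(K + M - 1) div M}"
    by (rule card_inj_on_le) simp
  then show ?thesis by simp
qed

lemma obtain_enumeration:
  assumes "finite A"
  obtains e where "bij_betw e {..<card A} A"
  using ex_bij_betw_nat_finite[OF assms] by (auto simp: atLeast0LessThan)

text \<open>Any \<open>M\<close> consecutive numbers meet every residue class; this finds a bar with
  a prescribed label on a cyclically labelled row.\<close>

lemma ex_residue:
  fixes a b M :: nat
  assumes "a < M"
  obtains i where "i < M" "(b + i) mod M = a"
proof
  let ?i = "(a + (M - b mod M)) mod M"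
  show "?i < M" using assms by simp
  have "b mod M < M" using assms by simp
  have "(b + ?i) mod M = (b mod M + (a + (M - b mod M))) mod M"
    by (simp add: mod_simps)
  also have "\<dots> = (a + M) mod M" using \<open>b mod M < M\<close> by simp
  finally show "(b + ?i) mod M = a" using assms by simp
qed

section \<open>The drawing for an even number of vertices in \<open>V\<close>\<close>

text \<open>A vertex of \<open>V\<close> lives on a single row, at every second of about
  \<open>m / 2\<close> positions. A vertex of \<open>U\<close> appears only on every second of the
  \<open>h + 1\<close> rows for \<open>U\<close>, and there about once.\<close>

lemma drawing_even:
  fixes U V :: "'a set"
  assumes disj: "U \<inter> V = {}" and U: "card U = m" "2 \<le> m" and V: "finite V" "card V = 2 * h" "0 < h" "h \<le> m div 2"
  shows "\<exists>S. drawing U V S \<and> (\<forall>v\<in>V. 4 * copies S v \<le> m + 5) \<and>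
    (\<forall>u\<in>U. copies S u \<le> h div 2 + 3)"
proof -
  \<comment> \<open>Row \<open>2 * s\<close> carries the half \<open>s mod 2\<close> of \<open>U\<close>, which has \<open>M (s mod 2)\<close> vertices. Its labels continue
    cyclically from row \<open>2 * (s - 2)\<close>, so that the surplus positions are spread evenly over the half.\<close>
  define M where "M = (\<lambda>c::nat. (m + 1 - c) div 2)"
  \<comment> \<open>The additional position makes up for the one end bar that sees too few bars of
    the neighbouring row.\<close>
  define L where "L = M 0 + 1"
  have M: "0 < M 0" "0 < M 1" "M 0 + M 1 = m" "M 1 \<le> M 0" "M 0 \<le> M 1 + 1" "h \<le> M 1"
    unfolding M_def using U V by auto
  have finU: "finite U" using U by (metis card.infinite not_numeral_le_zero)
  obtain e where e: "bij_betw e {..<m} U" using obtain_enumeration[OF finU] U by auto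
  obtain e' where e': "bij_betw e' {..<2 * h} V" using obtain_enumeration[OF V(1)] V by auto
  define idx where "idx = (\<lambda>s i. (s mod 2) * M 0 + ((s div 2) * L + i) mod M (s mod 2))"
  define lab where "lab = (\<lambda>r i. if even r then e (idx (r div 2) i) else e' (r - 1 + i mod 2))"
  define x :: "nat \<Rightarrow> nat \<Rightarrow> real" where "x = (\<lambda>r i. real i + real r / 2)"
  have Ms: "0 < M (s mod 2)" for s using M by (cases "even s") (auto simp: odd_iff_mod_2_eq_one)
  have idx_less: "idx s i < m" for s i
  proof -
    have *: "(s div 2 * L + i) mod M (s mod 2) < M (s mod 2)" using Ms by simp
    have "s mod 2 = 0 \<or> s mod 2 = 1" by presburger
    then show ?thesis
    proof
      assume s: "s mod 2 = 0"
      show ?thesis using * M(3) unfolding idx_def s by linarith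
    next
      assume s: "s mod 2 = 1"
      show ?thesis using * M(3) unfolding idx_def s by linarith
    qed
  qed
  have "\<exists>S. drawing U V S \<and> (\<forall>v. copies S v \<le> card {(r, i). r < 2 * h + 1 \<and> i < L \<and> lab r i = v})"
  proof (rule drawing_rows[where x = x])
    fix r i assume r: "r < 2 * h + 1" "i < L"
    show "lab r i \<in> (if even r then U else V)"
    proof (cases "even r")
      case True
      then show ?thesis using idx_less e by (auto simp: lab_def bij_betw_def)
    next
      case False
      then have "r - 1 + i mod 2 < 2 * h" using r by presburger
      then show ?thesis using False e' by (auto simp: lab_def bij_betw_def)
    qed
  next
    fix r i j :: nat assume "i < j"
    then have "real i + 1 \<le> real j" by linarith
    then show "x r i + 1 \<le> x r j" by (simp add: x_def)
  next
    fix r r' i j z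
    assume *: "r < r'" "r' < 2 * h + 1" "even r = even r'" "i < L" "j < L"
      "x r i < z" "z < x r i + 1" "x r' j < z" "z < x r' j + 1"
    have r': "r + 2 \<le> r'" using * by presburger
    \<comment> \<open>Row \<open>r + 1\<close> has no gaps, so rounding down finds its bar at
      \<open>z\<close>. The bar of row \<open>r'\<close> keeps \<open>z\<close> to the right of the
      start of row \<open>r + 1\<close>, and the bar of row \<open>r\<close> keeps it to the left of
      its end.\<close>
    define k where "k = nat \<lfloor>z - real (r + 1) / 2\<rfloor>"
    have "0 \<le> z - real (r + 1) / 2" using * r' by (simp add: x_def)
    then have k: "real k \<le> z - real (r + 1) / 2" "z - real (r + 1) / 2 < real k + 1"
      unfolding k_def by linarith+
    have "real i + 1 \<le> real L" using *(4) by linarith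
    then have "real k < real L" using * k by (simp add: x_def field_simps)
    with k r' show "\<exists>q k. r < q \<and> q < r' \<and> k < L \<and> x q k \<le> z \<and> z \<le> x q k + 1"
      by (intro exI[of _ "r + 1"] exI[of _ k]) (auto simp: x_def)
  next
    fix u v assume "u \<in> U" "v \<in> V"
    then obtain a b where a: "a < m" "u = e a" and b: "b < 2 * h" "v = e' b"
      using e e' by (auto simp: bij_betw_def)
    define c :: nat where "c = (if a < M 0 then 0 else 1)"
    define t where "t = b div 2"
    have t: "t < h" using b t_def by simp
    \<comment> \<open>The row of \<open>v\<close> lies between the rows for \<open>U\<close> with
      indices \<open>t\<close> and \<open>t + 1\<close>. These carry different halves, and
      \<open>s\<close> is the one whose half contains \<open>u\<close>.\<close>
    define s where "s = (if t mod 2 = c then t else t + 1)"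
    have s: "s mod 2 = c" unfolding s_def c_def by presburger
    have ac: "a - c * M 0 < M c" "c * M 0 \<le> a" using a M by (auto simp: c_def)
    have McL: "M c + 1 \<le> L" using M by (auto simp: c_def L_def)
    \<comment> \<open>The first bar of a row sees only one bar of the row above, the last one only one bar of the row below.\<close>
    define lo :: nat where "lo = (if s = t then 1 else 0)"
    obtain i0 where i0: "i0 < M c" "((s div 2) * L + lo + i0) mod M c = a - c * M 0"
      using ex_residue[OF ac(1)] by blast
    define i where "i = lo + i0"
    have iL: "i < L" using i0 McL by (auto simp: i_def lo_def)
    have idx: "idx s i = a" using i0 s ac by (simp add: idx_def i_def add.assoc)
    have lab_u: "lab (2 * s) i = u" using idx a by (simp add: lab_def)
    have lab_v: "lab (2 * t + 1) j = v" if "j mod 2 = b mod 2" for j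
    proof -
      have "2 * t + j mod 2 = b" unfolding that t_def by simp
      then show ?thesis using b by (simp add: lab_def)
    qed
    show "\<exists>r i r' j a b. r < r' \<and> r' < 2 * h + 1 \<and> i < L \<and> j < L \<and>
      (lab r i = u \<and> lab r' j = v \<or> lab r i = v \<and> lab r' j = u) \<and> a < b \<and>
      x r i \<le> a \<and> b \<le> x r i + 1 \<and> x r' j \<le> a \<and> b \<le> x r' j + 1 \<and>
      (\<forall>q k. r < q \<longrightarrow> q < r' \<longrightarrow> k < L \<longrightarrow> b \<le> x q k \<or> x q k + 1 \<le> a)"
    proof (cases "s = t")
      case True
      then have i1: "1 \<le> i" by (simp add: i_def lo_def)
      \<comment> \<open>The half-bar shift makes the bar at \<open>i\<close> overlap positions
        \<open>i - 1\<close> and \<open>i\<close> of the row above; the one with the parity of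
        \<open>b\<close> belongs to \<open>v\<close>.\<close>
      define j where "j = (if i mod 2 = b mod 2 then i else i - 1)"
      obtain i' where i': "i = Suc i'" using i1 by (cases i) auto
      have j: "j mod 2 = b mod 2" "j = i \<or> j + 1 = i"
        by (auto simp: j_def i' mod_Suc split: if_splits)
      have xs: "x (2 * s) i = real i + real s" "x (2 * t + 1) j = real j + real s + 1 / 2"
        using True by (auto simp: x_def)
      show ?thesis
      proof (rule exI[of _ "2 * s"], rule exI[of _ i], rule exI[of _ "2 * t + 1"], rule exI[of _ j],
          rule exI[of _ "max (x (2 * s) i) (x (2 * t + 1) j)"],
          rule exI[of _ "min (x (2 * s) i) (x (2 * t + 1) j) + 1"], intro conjI allI impI)
        show "2 * s < 2 * t + 1" "2 * t + 1 < 2 * h + 1" using True t by auto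
        show "i < L" "j < L" using iL j by auto
        show "lab (2 * s) i = u \<and> lab (2 * t + 1) j = v \<or> lab (2 * s) i = v \<and> lab (2 * t + 1) j = u"
          using lab_u lab_v j by blast
        show "max (x (2 * s) i) (x (2 * t + 1) j) < min (x (2 * s) i) (x (2 * t + 1) j) + 1"
          unfolding xs using j(2) by auto
        fix q k assume "2 * s < q" "q < 2 * t + 1"
        then show "min (x (2 * s) i) (x (2 * t + 1) j) + 1 \<le> x q k \<or>
          x q k + 1 \<le> max (x (2 * s) i) (x (2 * t + 1) j)" using True by simp
      qed auto
    next
      case False
      then have st: "s = t + 1" by (auto simp: s_def split: if_splits)
      have i1: "i + 1 < L" using False i0 McL by (simp add: i_def lo_def)
      \<comment> \<open>In the row below, the overlapping positions are \<open>i\<close> and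
        \<open>i + 1\<close>.\<close>
      define j where "j = (if i mod 2 = b mod 2 then i else i + 1)"
      have j: "j mod 2 = b mod 2" "j = i \<or> j = i + 1"
        by (auto simp: j_def mod_Suc split: if_splits)
      have xs: "x (2 * s) i = real i + real t + 1" "x (2 * t + 1) j = real j + real t + 1 / 2"
        using st by (auto simp: x_def)
      show ?thesis
      proof (rule exI[of _ "2 * t + 1"], rule exI[of _ j], rule exI[of _ "2 * s"], rule exI[of _ i],
          rule exI[of _ "max (x (2 * s) i) (x (2 * t + 1) j)"],
          rule exI[of _ "min (x (2 * s) i) (x (2 * t + 1) j) + 1"], intro conjI allI impI)
        show "2 * t + 1 < 2 * s" "2 * s < 2 * h + 1" using st t by auto
        show "i < L" "j < L" using i1 j by auto
        show "lab (2 * t + 1) j = u \<and> lab (2 * s) i = v \<or> lab (2 * t + 1) j = v \<and> lab (2 * s) i = u"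
          using lab_u lab_v j by blast
        show "max (x (2 * s) i) (x (2 * t + 1) j) < min (x (2 * s) i) (x (2 * t + 1) j) + 1"
          unfolding xs using j(2) by auto
        fix q k assume "2 * t + 1 < q" "q < 2 * s"
        then show "min (x (2 * s) i) (x (2 * t + 1) j) + 1 \<le> x q k \<or>
          x q k + 1 \<le> max (x (2 * s) i) (x (2 * t + 1) j)" using st by simp
      qed auto
    qed
  qed (rule disj)
  then obtain S where S: "drawing U V S"
    and cop: "\<And>v. copies S v \<le> card {(r, i). r < 2 * h + 1 \<and> i < L \<and> lab r i = v}" by blast
  have "4 * copies S v \<le> m + 5" if v: "v \<in> V" for v
  proof -
    obtain b where b: "b < 2 * h" "v = e' b" using v e' by (auto simp: bij_betw_def)
    let ?A = "{(r, i). r < 2 * h + 1 \<and> i < L \<and> lab r i = v}"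
    have sub: "?A \<subseteq> Pair (2 * (b div 2) + 1) ` {i. i < L \<and> i mod 2 = b mod 2}"
    proof clarify
      fix r i assume *: "r < 2 * h + 1" "i < L" "v = lab r i"
      have "odd r"
      proof
        assume "even r"
        then have "v \<in> U" using *(3) idx_less e by (auto simp: lab_def bij_betw_def)
        then show False using v disj by blast
      qed
      then have "r - 1 + i mod 2 < 2 * h" "e' (r - 1 + i mod 2) = e' b"
        using * b by (simp_all add: lab_def) presburger
      then have eq: "b = r - 1 + i mod 2" using e' b(1) by (auto simp: bij_betw_def dest: inj_onD)
      obtain r' where r': "r = 2 * r' + 1" using \<open>odd r\<close> by (rule oddE)
      have "r = 2 * (b div 2) + 1" "i mod 2 = b mod 2" unfolding eq r' by simp_all
      then show "(r, i) \<in> Pair (2 * (b div 2) + 1) ` {i. i < L \<and> i mod 2 = b mod 2}"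
        using *(2) by simp
    qed
    have "copies S v \<le> card ?A" by (rule cop)
    also have "\<dots> \<le> card (Pair (2 * (b div 2) + 1) ` {i. i < L \<and> i mod 2 = b mod 2})"
      using sub by (intro card_mono) auto
    also have "\<dots> \<le> card {i. i < L \<and> i mod 2 = b mod 2}" by (intro card_image_le) auto
    also have "\<dots> \<le> (L + 2 - 1) div 2" by (rule card_residue_le) simp
    finally have "2 * copies S v \<le> L + 1" by simp
    moreover have "2 * L \<le> m + 3" using M by (simp add: L_def)
    ultimately show ?thesis by simp
  qed
  moreover have "copies S u \<le> h div 2 + 3" if u: "u \<in> U" for u
  proof -
    obtain a where a: "a < m" "u = e a" using u e by (auto simp: bij_betw_def)
    define c :: nat where "c = (if a < M 0 then 0 else 1)"
    \<comment> \<open>Rows for \<open>U\<close> have index \<open>s <= h\<close>, so at most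
      \<open>h div 2 + 1\<close> of them carry the half \<open>c\<close>. Their positions are
      numbered consecutively, and \<open>K\<close> bounds these numbers.\<close>
    define K where "K = (h div 2 + 1) * L"
    have Mc: "0 < M c" "h \<le> M c" "L \<le> M c + 2" using M by (auto simp: c_def L_def)
    let ?A = "{(r, i). r < 2 * h + 1 \<and> i < L \<and> lab r i = u}"
    \<comment> \<open>This inverts the numbering: the row with index \<open>s = 2 * q + c\<close> is
      row \<open>4 * q + 2 * c\<close>.\<close>
    define g where "g = (\<lambda>p. (4 * (p div L) + 2 * c, p mod L))"
    have sub: "?A \<subseteq> g ` {p. p < K \<and> p mod M c = a - c * M 0}"
    proof clarify
      fix r i assume *: "r < 2 * h + 1" "i < L" "u = lab r i"
      have ev: "even r"
      proof (rule ccontr)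
        assume "odd r"
        then have "r - 1 + i mod 2 < 2 * h" using *(1) by presburger
        then have "u \<in> V" using *(3) \<open>odd r\<close> e' by (auto simp: lab_def bij_betw_def)
        then show False using u disj by blast
      qed
      define s where "s = r div 2"
      have r: "r = 2 * s" using ev by (simp add: s_def)
      have "e (idx s i) = e a" using *(3) a ev by (simp add: lab_def s_def)
      then have idx: "idx s i = a" using e idx_less a(1) by (auto simp: bij_betw_def dest: inj_onD)
      have sc: "s mod 2 = c"
      proof (cases "even s")
        case True
        then have "idx s i < M 0" using M by (simp add: idx_def)
        then show ?thesis using idx True by (simp add: c_def)
      next
        case False
        then have "s mod 2 = 1" by presburger
        then show ?thesis using idx by (auto simp: c_def idx_def)
      qed
      define p where "p = (s div 2) * L + i"
      have "p mod M c = a - c * M 0" using idx sc by (simp add: idx_def p_def)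
      moreover have "p < K"
      proof -
        have "s div 2 + 1 \<le> h div 2 + 1" using *(1) r by simp
        then have "(s div 2 + 1) * L \<le> K" unfolding K_def by (rule mult_le_mono1)
        then show ?thesis using *(2) by (simp add: p_def)
      qed
      moreover have "g p = (r, i)"
      proof -
        have "2 * (s div 2) + c = s" using sc by presburger
        then show ?thesis using *(2) by (simp add: g_def p_def r)
      qed
      ultimately show "(r, i) \<in> g ` {p. p < K \<and> p mod M c = a - c * M 0}" by force
    qed
    have "copies S u \<le> card ?A" by (rule cop)
    also have "\<dots> \<le> card (g ` {p. p < K \<and> p mod M c = a - c * M 0})"
      using sub by (intro card_mono) auto
    also have "\<dots> \<le> card {p. p < K \<and> p mod M c = a - c * M 0}" by (intro card_image_le) auto
    also have "\<dots> \<le> (K + M c - 1) div M c" using Mc(1) by (rule card_residue_le)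
    also have "\<dots> \<le> h div 2 + 3"
    proof -
      \<comment> \<open>Each row has at most two surplus positions. Together they number at most
        \<open>2 * h\<close>, as \<open>0 < h\<close>, and hence at most two further rounds through
        the half, as \<open>h <= M c\<close>.\<close>
      have "K \<le> (h div 2 + 1) * (M c + 2)" unfolding K_def using Mc by (intro mult_le_mono2)
      also have "\<dots> = (h div 2 + 1) * M c + 2 * (h div 2 + 1)" by (simp add: algebra_simps)
      also have "2 * (h div 2 + 1) \<le> 2 * h" using V(3) by presburger
      also have "2 * h \<le> 2 * M c" using Mc by simp
      finally have "K + M c - 1 < (h div 2 + 4) * M c" using Mc(1) by (simp add: algebra_simps)
      then have "(K + M c - 1) div M c < h div 2 + 4" by (simp add: less_mult_imp_div_less)
      then show ?thesis by simp
    qed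
    finally show ?thesis .
  qed
  ultimately show ?thesis using S by blast
qed

section \<open>The separate drawing for three vertices\<close>

text \<open>Seven rows suffice: the \<open>4 * N - 2\<close> bars of \<open>U\<close> each see all
  three vertices, while the \<open>3 * N + 1\<close> bars of \<open>W\<close> are shared almost
  equally, giving about \<open>N\<close>, that is \<open>m / 4\<close>, per vertex.\<close>

lemma drawing_three:
  fixes U W :: "'a set"
  assumes disj: "U \<inter> W = {}" and U: "card U = m" "3 \<le> m" and W: "card W = 3"
  shows "\<exists>S. drawing U W S \<and> (\<forall>v\<in>W. 4 * copies S v \<le> m + 16) \<and> (\<forall>u\<in>U. copies S u \<le> 2)"
proof -
  \<comment> \<open>The least \<open>N\<close> with \<open>m <= 4 * N - 2\<close>.\<close>
  define N where "N = (m + 5) div 4"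
  have N: "2 \<le> N" "m \<le> 4 * N - 2" "4 * N \<le> m + 5" using U unfolding N_def by linarith+
  have fin: "finite U" "finite W"
    using U W by (auto intro!: card_ge_0_finite)
  obtain e where e: "bij_betw e {..<m} U" using obtain_enumeration[OF fin(1)] U by auto
  obtain w where w: "bij_betw w {..<3::nat} W" using obtain_enumeration[OF fin(2)] W by auto
  \<comment> \<open>Row 3 is a gapless row of bars of \<open>W\<close>. Rows 1 and 5 are bars of \<open>W\<close> with tiny gaps, each covering a
    break of row 3; rows 2 and 4 are bars of \<open>U\<close> in exactly the same horizontal positions. A bar of \<open>U\<close>
    in row 0 or 6 sees two bars of row 1 or 5 and, through the gap between them, one of row 3. The
    labels on the zigzag of row 3 and row 1 or 5 run cyclically through the three vertices.\<close>
  define len where "len = (\<lambda>r::nat. if r = 0 \<or> r = 6 then N - 1 else if r = 3 then N + 1 else N)"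
  \<comment> \<open>Successive offsets differ by the gap width \<open>1 / (4 * N)\<close>. They stay
    at most \<open>1 / 4\<close> in total, so bar \<open>i\<close> of a shifted row still straddles
    the break of row 3 at \<open>i + 1\<close>.\<close>
  define d where "d = (\<lambda>i. real i / (4 * real N))"
  define x :: "nat \<Rightarrow> nat \<Rightarrow> real" where
    "x = (\<lambda>r i. if r = 0 \<or> r = 6 then real i + 1 else if r = 3 then real i
      else real i + 1 / 2 + d i)"
  \<comment> \<open>A consecutive numbering of all bars of \<open>U\<close>; reduced modulo
    \<open>m\<close> it reaches every vertex.\<close>
  define slot where "slot = (\<lambda>(r::nat) i. if r = 0 then i else if r = 2 then N - 1 + i
    else if r = 4 then 2 * N - 1 + i else 3 * N - 1 + i)"
  define lab where "lab = (\<lambda>r i. if even r then e (slot r i mod m)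
    else w ((if r = 3 then 2 * i else 2 * i + 1) mod 3))"
  define Q where "Q = (\<lambda>r i r' j. \<exists>a b. a < b \<and> x r i \<le> a \<and> b \<le> x r i + 1 \<and> x r' j \<le> a \<and> b \<le> x r' j + 1 \<and>
    (\<forall>q k. r < q \<longrightarrow> q < r' \<longrightarrow> k < len q \<longrightarrow> b \<le> x q k \<or> x q k + 1 \<le> a))"
  have d_mono: "d i < d j" if "i < j" for i j
    unfolding d_def using that N by (intro divide_strict_right_mono) auto
  have d_le: "d i \<le> 1 / 4" if "i \<le> N" for i
    unfolding d_def using that N by (simp add: divide_le_eq)
  have d_ge: "0 \<le> d i" for i by (simp add: d_def)
  have step: "x r i + 1 \<le> x r j" if "i < j" for r i j
  proof -
    have "real i + 1 \<le> real j" using that by linarith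
    then show ?thesis using d_mono[OF that] by (simp add: x_def)
  qed
  have "\<exists>S. drawing U W S \<and> (\<forall>v. copies S v \<le> card {(r, i). r < 7 \<and> i < len r \<and> lab r i = v})"
  proof (rule drawing_rows[where x = x])
    fix r i assume "i < len r"
    show "lab r i \<in> (if even r then U else W)"
      using e w U by (auto simp: lab_def bij_betw_def)
  next
    fix r i j :: nat assume "i < j"
    then show "x r i + 1 \<le> x r j" by (rule step)
  next
    fix r r' i j z
    assume *: "r < r'" "r' < 7" "even r = even r'" "i < len r" "j < len r'"
      "x r i < z" "z < x r i + 1" "x r' j < z" "z < x r' j + 1"
    have "r = 0 \<and> r' = 2 \<or> r = 4 \<and> r' = 6 \<or> r = 1 \<and> (r' = 3 \<or> r' = 5) \<or> r = 3 \<and> r' = 5 \<or>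
      (r = 0 \<or> r = 2) \<and> (r' = 4 \<or> r' = 6)"
      using *(1-3) by presburger
    \<comment> \<open>In the first four cases a row in between repeats the horizontal positions of
      one of the two rows exactly; in the last case the gapless row 3 blocks.\<close>
    then consider "r = 0" "r' = 2" | "r = 4" "r' = 6" | "r = 1" "r' = 3 \<or> r' = 5" | "r = 3" "r' = 5" |
      "r = 0 \<or> r = 2" "r' = 4 \<or> r' = 6" by blast
    then show "\<exists>q k. r < q \<and> q < r' \<and> k < len q \<and> x q k \<le> z \<and> z \<le> x q k + 1"
    proof cases
      case 1
      with * show ?thesis by (intro exI[of _ 1] exI[of _ j]) (auto simp: x_def len_def)
    next
      case 2
      with * show ?thesis by (intro exI[of _ 5] exI[of _ i]) (auto simp: x_def len_def)
    next
      case 3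
      with * show ?thesis by (intro exI[of _ 2] exI[of _ i]) (auto simp: x_def len_def)
    next
      case 4
      with * show ?thesis by (intro exI[of _ 4] exI[of _ j]) (auto simp: x_def len_def)
    next
      case 5
      have "i < N" using 5 * by (auto simp: len_def split: if_splits)
      then have iN: "real i + 1 \<le> real N" by linarith
      have "real i \<le> x r i \<and> x r i + 1 \<le> real N + 3 / 4"
      proof (cases "r = 0")
        case True
        then have "i + 2 \<le> N" using * by (simp add: len_def)
        then have "real i + 2 \<le> real N" by linarith
        then show ?thesis using True by (simp add: x_def)
      next
        case False
        then have "x r i = real i + 1 / 2 + d i" using 5(1) by (auto simp: x_def)
        then show ?thesis using d_le[OF less_imp_le[OF \<open>i < N\<close>]] d_ge[of i] iN by linarith
      qed
      then have z: "0 \<le> z" "z < real N + 1" using * by linarith+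
      define k where "k = nat \<lfloor>z\<rfloor>"
      have k: "real k \<le> z" "z < real k + 1" using z(1) unfolding k_def by linarith+
      then have "k < N + 1" using z(2) by linarith
      with 5 k show ?thesis by (intro exI[of _ 3] exI[of _ k]) (auto simp: x_def len_def)
    qed
  next
    fix u v assume "u \<in> U" "v \<in> W"
    then obtain a b where a: "a < m" "u = e a" and b: "b < 3" "v = w b"
      using e w by (auto simp: bij_betw_def)
    have adj: "Q r i r' j" if "r' = Suc r" "x r i < x r' j + 1" "x r' j < x r i + 1" for r i r' j
      unfolding Q_def
      by (rule exI[of _ "max (x r i) (x r' j)"], rule exI[of _ "min (x r i) (x r' j) + 1"])
        (use that in auto)
    \<comment> \<open>The gap after bar \<open>i\<close> is at the same place in rows 1, 2, 4 and 5,
      so the strip from \<open>lo\<close> to \<open>hi\<close> is free on both sides of row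
      3.\<close>
    have gap: "Q 0 i 3 (i + 1)" "Q 3 (i + 1) 6 i" if i: "i + 1 < N" for i
    proof -
      define lo hi where "lo = real i + 3 / 2 + d i"
        and "hi = real i + 3 / 2 + d (i + 1)"
      have lohi: "lo < hi" using d_mono[of i "i + 1"] by (simp add: lo_def hi_def)
      have out: "hi \<le> x q k \<or> x q k + 1 \<le> lo" if q: "q = 1 \<or> q = 2 \<or> q = 4 \<or> q = 5" for q k
      proof -
        have xi: "x q i + 1 = lo" "x q (i + 1) = hi" using q by (auto simp: x_def lo_def hi_def)
        consider "k < i" | "k = i" | "k = i + 1" | "i + 1 < k" by linarith
        then show ?thesis
          using step[of k i q] step[of "i + 1" k q] xi by cases auto
      qed
      have xs: "x 0 i = real i + 1" "x 6 i = real i + 1" "x 3 (i + 1) = real i + 1"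
        by (auto simp: x_def)
      have bounds: "real i + 1 \<le> lo" "hi \<le> real i + 1 + 1"
        using d_ge[of i] d_le[of "i + 1"] i by (simp_all add: lo_def hi_def)
      show "Q 0 i 3 (i + 1)"
        unfolding Q_def xs
      proof (rule exI[of _ lo], rule exI[of _ hi], intro conjI allI impI)
        fix q k :: nat assume "0 < q" "q < 3"
        then have "q = 1 \<or> q = 2 \<or> q = 4 \<or> q = 5" by presburger
        then show "hi \<le> x q k \<or> x q k + 1 \<le> lo" by (rule out)
      qed (fact lohi bounds)+
      show "Q 3 (i + 1) 6 i"
        unfolding Q_def xs
      proof (rule exI[of _ lo], rule exI[of _ hi], intro conjI allI impI)
        fix q k :: nat assume "3 < q" "q < 6"
        then have "q = 1 \<or> q = 2 \<or> q = 4 \<or> q = 5" by presburger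
        then show "hi \<le> x q k \<or> x q k + 1 \<le> lo" by (rule out)
      qed (fact lohi bounds)+
    qed
    have lab_w: "lab 1 i = w ((2 * i + 1) mod 3)" "lab 5 i = w ((2 * i + 1) mod 3)"
      "lab 3 i = w ((2 * i) mod 3)" for i by (simp_all add: lab_def)
    have shift: "2 * (i + 1) mod 3 = (2 * i + 2) mod 3" "(2 * (i + 1) + 1) mod 3 = (2 * i) mod 3"
      for i :: nat by presburger+
    \<comment> \<open>The three bars of \<open>W\<close> seen by a bar of \<open>U\<close> carry
      consecutive places of the zigzag, hence all three residues.\<close>
    have b3: "(2 * i) mod 3 = b \<or> (2 * i + 1) mod 3 = b \<or> (2 * i + 2) mod 3 = b" for i
      using b(1) by presburger
    have "\<exists>r i r' j. r < r' \<and> r' < 7 \<and> i < len r \<and> j < len r' \<and>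
      (lab r i = u \<and> lab r' j = v \<or> lab r i = v \<and> lab r' j = u) \<and> Q r i r' j"
      (is "\<exists>r i r' j. ?P r i r' j")
    proof -
      have "a < 4 * N - 2" using a N by simp
      then consider i where "a = i" "i + 1 < N" | i where "a = N - 1 + i" "i < N" |
        i where "a = 2 * N - 1 + i" "i < N" | i where "a = 3 * N - 1 + i" "i + 1 < N"
      proof -
        have "a + 1 < N \<or> (N - 1 \<le> a \<and> a < 2 * N - 1) \<or> (2 * N - 1 \<le> a \<and> a < 3 * N - 1) \<or>
          (3 * N - 1 \<le> a \<and> a < 4 * N - 2)" using \<open>a < 4 * N - 2\<close> by linarith
        then show ?thesis
        proof (elim disjE conjE)
          assume "a + 1 < N"
          then show ?thesis by (rule that(1)[OF refl])
        next
          assume "N - 1 \<le> a" "a < 2 * N - 1"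
          then have "a = N - 1 + (a - (N - 1))" "a - (N - 1) < N" using N(1) by linarith+
          then show ?thesis by (rule that(2))
        next
          assume "2 * N - 1 \<le> a" "a < 3 * N - 1"
          then have "a = 2 * N - 1 + (a - (2 * N - 1))" "a - (2 * N - 1) < N" using N(1) by linarith+
          then show ?thesis by (rule that(3))
        next
          assume "3 * N - 1 \<le> a" "a < 4 * N - 2"
          then have "a = 3 * N - 1 + (a - (3 * N - 1))" "a - (3 * N - 1) + 1 < N" using N(1) by linarith+
          then show ?thesis by (rule that(4))
        qed
      qed
      then show ?thesis
      proof cases
        case (1 i)
        have u: "lab 0 i = u" using 1 a by (simp add: lab_def slot_def)
        have "Q 0 i 1 i" "Q 0 i 1 (i + 1)"
          by (rule adj; use 1(2) d_le[of i] d_le[of "i + 1"] d_ge[of i] d_ge[of "i + 1"] in \<open>simp add: x_def\<close>)+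
        moreover have "i < len 0" "i < len 1" "i + 1 < len 1" "i + 1 < len 3"
          using 1 by (auto simp: len_def)
        ultimately have "?P 0 i 1 i \<or> ?P 0 i 3 (i + 1) \<or> ?P 0 i 1 (i + 1)"
          using gap(1)[OF 1(2)] b3[of i] u b(2) unfolding lab_w shift by auto
        then show ?thesis by blast
      next
        case (2 i)
        have u: "lab 2 i = u" using 2 a by (simp add: lab_def slot_def)
        have "Q 1 i 2 i" "Q 2 i 3 i" "Q 2 i 3 (i + 1)"
          by (rule adj; use 2(2) d_le[of i] d_le[of "i + 1"] d_ge[of i] d_ge[of "i + 1"] in \<open>simp add: x_def\<close>)+
        moreover have "i < len 1" "i < len 2" "i < len 3" "i + 1 < len 3"
          using 2 by (auto simp: len_def)
        ultimately have "?P 1 i 2 i \<or> ?P 2 i 3 i \<or> ?P 2 i 3 (i + 1)"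
          using b3[of i] u b(2) unfolding lab_w shift by auto
        then show ?thesis by blast
      next
        case (3 i)
        have u: "lab 4 i = u" using 3 a N by (simp add: lab_def slot_def)
        have "Q 4 i 5 i" "Q 3 i 4 i" "Q 3 (i + 1) 4 i"
          by (rule adj; use 3(2) d_le[of i] d_le[of "i + 1"] d_ge[of i] d_ge[of "i + 1"] in \<open>simp add: x_def\<close>)+
        moreover have "i < len 4" "i < len 5" "i < len 3" "i + 1 < len 3"
          using 3 by (auto simp: len_def)
        ultimately have "?P 4 i 5 i \<or> ?P 3 i 4 i \<or> ?P 3 (i + 1) 4 i"
          using b3[of i] u b(2) unfolding lab_w shift by auto
        then show ?thesis by blast
      next
        case (4 i)
        have u: "lab 6 i = u" using 4 a N by (simp add: lab_def slot_def)
        have "Q 5 i 6 i" "Q 5 (i + 1) 6 i"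
          by (rule adj; use 4(2) d_le[of i] d_le[of "i + 1"] d_ge[of i] d_ge[of "i + 1"] in \<open>simp add: x_def\<close>)+
        moreover have "i < len 6" "i < len 5" "i + 1 < len 5" "i + 1 < len 3"
          using 4 by (auto simp: len_def)
        ultimately have "?P 5 i 6 i \<or> ?P 3 (i + 1) 6 i \<or> ?P 5 (i + 1) 6 i"
          using gap(2)[OF 4(2)] b3[of i] u b(2) unfolding lab_w shift by auto
        then show ?thesis by blast
      qed
    qed
    then show "\<exists>r i r' j a b. r < r' \<and> r' < 7 \<and> i < len r \<and> j < len r' \<and>
      (lab r i = u \<and> lab r' j = v \<or> lab r i = v \<and> lab r' j = u) \<and> a < b \<and>
      x r i \<le> a \<and> b \<le> x r i + 1 \<and> x r' j \<le> a \<and> b \<le> x r' j + 1 \<and>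
      (\<forall>q k. r < q \<longrightarrow> q < r' \<longrightarrow> k < len q \<longrightarrow> b \<le> x q k \<or> x q k + 1 \<le> a)"
      unfolding Q_def by (elim exE conjE) (intro exI conjI; assumption)
  qed (rule disj)
  then obtain S where S: "drawing U W S"
    and cop: "\<And>v. copies S v \<le> card {(r, i). r < 7 \<and> i < len r \<and> lab r i = v}" by blast
  have labU: "lab r i \<in> U \<longleftrightarrow> even r" for r i
    using e w U disj by (auto simp: lab_def bij_betw_def)
  have "4 * copies S v \<le> m + 16" if v: "v \<in> W" for v
  proof -
    obtain b where b: "b < 3" "v = w b" using v w by (auto simp: bij_betw_def)
    let ?A = "{(r, i). r < 7 \<and> i < len r \<and> lab r i = v}"
    \<comment> \<open>As 2 is its own inverse modulo 3, \<open>2 * i\<close> has residue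
      \<open>b\<close> exactly if \<open>i\<close> is congruent to \<open>2 * b\<close>, and
      \<open>2 * i + 1\<close> exactly if \<open>i\<close> is congruent to
      \<open>2 * b + 1\<close>.\<close>
    define B where "B = (\<lambda>K c. {i::nat. i < K \<and> i mod 3 = c mod 3})"
    define P where "P = (\<lambda>(r::nat) K c. Pair r ` B K c)"
    have cardP: "card (P r K c) \<le> (K + 2) div 3" for r K c
    proof -
      have "card (P r K c) \<le> card (B K c)" unfolding P_def by (intro card_image_le) (simp add: B_def)
      also have "\<dots> \<le> (K + 3 - 1) div 3" unfolding B_def by (rule card_residue_le) simp
      finally show ?thesis by simp
    qed
    have "?A \<subseteq> P 1 N (2 * b + 1) \<union> (P 5 N (2 * b + 1) \<union> P 3 (N + 1) (2 * b))"
    proof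
      fix z assume "z \<in> ?A"
      then obtain r i where z: "z = (r, i)" and *: "r < 7" "i < len r" "v = lab r i" by blast
      have "odd r" using labU[of r i] *(3) v disj by blast
      then have r: "r = 1 \<or> r = 3 \<or> r = 5" using *(1) by presburger
      have "w ((if r = 3 then 2 * i else 2 * i + 1) mod 3) = w b"
        using *(3) b \<open>odd r\<close> by (simp add: lab_def)
      then have eq: "b = (if r = 3 then 2 * i else 2 * i + 1) mod 3"
        using w b(1) by (auto simp: bij_betw_def dest: inj_onD split: if_splits)
      have "(2 * ((2 * i) mod 3)) mod 3 = (i + 3 * i) mod 3"
        by (simp add: mod_mult_right_eq)
      moreover have "(2 * ((2 * i + 1) mod 3) + 1) mod 3 = (2 * (2 * i + 1) + 1) mod 3"
        by (metis mod_add_left_eq mod_mult_right_eq)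
      moreover have "2 * (2 * i + 1) + 1 = i + 3 * (i + 1)" by simp
      ultimately have mod3: "i mod 3 = (2 * ((2 * i) mod 3)) mod 3"
        "i mod 3 = (2 * ((2 * i + 1) mod 3) + 1) mod 3"
        by (simp_all only: mod_mult_self2)
      have "r = 3 \<Longrightarrow> i \<in> B (N + 1) (2 * b)" "r \<noteq> 3 \<Longrightarrow> i \<in> B N (2 * b + 1)"
        using r eq mod3 *(2) by (auto simp: B_def len_def)
      with r show "z \<in> P 1 N (2 * b + 1) \<union> (P 5 N (2 * b + 1) \<union> P 3 (N + 1) (2 * b))"
        unfolding z P_def by blast
    qed
    then have "card ?A \<le> card (P 1 N (2 * b + 1) \<union>
        (P 5 N (2 * b + 1) \<union> P 3 (N + 1) (2 * b)))"
      by (intro card_mono) (auto simp: B_def P_def)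
    also have "\<dots> \<le> card (P 1 N (2 * b + 1)) +
        (card (P 5 N (2 * b + 1)) + card (P 3 (N + 1) (2 * b)))"
      by (intro order_trans[OF card_Un_le] add_left_mono card_Un_le)
    also have "\<dots> \<le> (N + 2) div 3 + ((N + 2) div 3 + (N + 1 + 2) div 3)"
      by (intro add_mono cardP)
    finally show ?thesis using cop[of v] N(3) by linarith
  qed
  moreover have "copies S u \<le> 2" if u: "u \<in> U" for u
  proof -
    obtain a where a: "a < m" "u = e a" using u e by (auto simp: bij_betw_def)
    let ?A = "{(r, i). r < 7 \<and> i < len r \<and> lab r i = u}"
    have AE: "(r = 0 \<or> r = 2 \<or> r = 4 \<or> r = 6) \<and> i < len r \<and> slot r i mod m = a" if "(r, i) \<in> ?A" for r i
    proof -
      from that have r: "even r" "r < 7" "i < len r" using labU[of r i] u by auto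
      then have "e (slot r i mod m) = e a" using that a by (simp add: lab_def)
      then have "slot r i mod m = a" using e a(1) by (auto simp: bij_betw_def dest: inj_onD)
      moreover have "r = 0 \<or> r = 2 \<or> r = 4 \<or> r = 6" using r by presburger
      ultimately show ?thesis using r by blast
    qed
    have "inj_on (\<lambda>(r, i). slot r i) ?A"
    proof (rule inj_onI; clarify)
      fix r i r' i' assume "r < 7" "i < len r" "u = lab r i" "r' < 7" "i' < len r'" "lab r' i' = lab r i"
        and eq: "slot r i = slot r' i'"
      then have "(r, i) \<in> ?A" "(r', i') \<in> ?A" by auto
      from this[THEN AE] eq show "r = r' \<and> i = i'"
        by (elim conjE disjE) (simp_all add: slot_def len_def)
    qed
    moreover have "(\<lambda>(r, i). slot r i) ` ?A \<subseteq> {p. p < 4 * N - 2 \<and> p mod m = a}"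
    proof (clarify)
      fix r i assume "r < 7" "i < len r" "u = lab r i"
      then have "(r, i) \<in> ?A" by auto
      from AE[OF this] N show "slot r i < 4 * N - 2 \<and> slot r i mod m = a"
        by (auto simp: slot_def len_def)
    qed
    ultimately have "card ?A \<le> card {p. p < 4 * N - 2 \<and> p mod m = a}"
      by (rule card_inj_on_le) simp
    also have "\<dots> \<le> (4 * N - 2 + m - 1) div m" using U by (intro card_residue_le) simp
    also have "\<dots> \<le> 2"
    proof -
      \<comment> \<open>From \<open>3 <= m\<close> there are at most \<open>m + 3 <= 2 * m\<close>
        slots, so no vertex is used more than twice.\<close>
      have "4 * N - 2 + m - 1 < 3 * m" using N U by linarith
      then have "(4 * N - 2 + m - 1) div m < 3" by (simp add: less_mult_imp_div_less)
      then show ?thesis by simp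
    qed
    finally show ?thesis using cop[of u] by simp
  qed
  ultimately show ?thesis using S by blast
qed

section \<open>Assembling the bound for complete bipartite graphs\<close>

lemma copies_eq_0:
  assumes "drawing U V S" "v \<notin> U \<union> V"
  shows "copies S v = 0"
proof -
  have "{p \<in> S. fst p = v} = {}" using assms by (auto simp: drawing_def)
  then show ?thesis unfolding copies_def by (simp only: card.empty)
qed

text \<open>The roughly \<open>n / 4\<close> bars of a vertex of \<open>U\<close> fit into
  \<open>m / 4\<close> because \<open>n <= m\<close>. The minimum is 5 except for
  \<open>n = 2\<close> and \<open>n = 3\<close>, where the smaller constants 3 and 4 are
  needed.\<close>

lemma ub_complete_bipartite_le:
  fixes G :: "('a, 'b) pre_digraph"
  assumes n: "2 \<le> n" "n \<le> m" and G: "K\<^bsub>m,n\<^esub> G"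
  shows "ub G \<le> (m + 4 * min 5 (n + 1)) div 4"
proof -
  obtain U V where UV: "verts G = U \<union> V" "U \<inter> V = {}" "card U = m" "card V = n"
    "arcs_ends G = U \<times> V \<union> V \<times> U"
    using G unfolding complete_bipartite_digraph_def by blast
  have finV: "finite V" using UV n by (metis card.infinite not_numeral_le_zero)
  have "\<exists>S. drawing U V S \<and> (\<forall>v\<in>U \<union> V. 4 * copies S v \<le> m + 4 * min 5 (n + 1))"
  proof (cases "even n")
    case True
    then obtain h where h: "n = 2 * h" by blast
    then obtain S where S: "drawing U V S" "\<forall>v\<in>V. 4 * copies S v \<le> m + 5"
      "\<forall>u\<in>U. copies S u \<le> h div 2 + 3"
      using drawing_even[of U V m h] UV finV n by force
    have "4 * copies S v \<le> m + 4 * min 5 (n + 1)" if "v \<in> U \<union> V" for v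
      using that
    proof
      assume "v \<in> U"
      with S(3) have "copies S v \<le> h div 2 + 3" by blast
      then have "4 * copies S v \<le> 2 * h + 12" by linarith
      then show ?thesis using n h by (simp add: min_def)
    next
      assume "v \<in> V"
      with S(2) have "4 * copies S v \<le> m + 5" by blast
      then show ?thesis using n by (simp add: min_def)
    qed
    with S(1) show ?thesis by blast
  next
    case False
    then have n3: "3 \<le> n" using n by presburger
    then obtain W where W: "W \<subseteq> V" "card W = 3" using UV(4) obtain_subset_with_card_n by metis
    define V1 where "V1 = V - W"
    have V1: "V = V1 \<union> W" "V1 \<inter> W = {}" "finite V1" "U \<inter> V1 = {}" "U \<inter> W = {}" "card V1 = n - 3"
      using W UV finV by (auto simp: V1_def card_Diff_subset finite_subset)
    obtain h where h: "n = 2 * h + 3"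
    proof -
      have "n = 2 * ((n - 3) div 2) + 3" using False n3 by presburger
      then show ?thesis by (rule that)
    qed
    \<comment> \<open>For \<open>n = 3\<close> nothing remains beside \<open>W\<close> and the empty
      drawing is taken. Its bound 0 matters: \<open>3 + 2\<close> bars would exceed the claim at
      \<open>m = 3\<close>.\<close>
    obtain S where S: "drawing U V1 S" "\<forall>v\<in>V1. 4 * copies S v \<le> m + 5"
      "\<forall>u\<in>U. copies S u \<le> (if h = 0 then 0 else h div 2 + 3)"
    proof (cases "h = 0")
      case True
      then have "V1 = {}" using V1 h by simp
      then have "drawing U V1 {}" by (simp add: drawing_def)
      then show ?thesis using that[of "{}"] True \<open>V1 = {}\<close> by (simp add: copies_def)
    next
      case False
      then show ?thesis using drawing_even[of U V1 m h] UV V1 n h that by force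
    qed
    obtain T where T: "drawing U W T" "\<forall>v\<in>W. 4 * copies T v \<le> m + 16" "\<forall>u\<in>U. copies T u \<le> 2"
      using drawing_three[of U W m] V1 UV W n n3 by force
    obtain R where R: "drawing U (V1 \<union> W) R" "\<And>v. copies R v \<le> copies S v + copies T v"
      using drawing_union[OF S(1) T(1) V1(4,5)] by blast
    have "4 * copies R v \<le> m + 4 * min 5 (n + 1)" if "v \<in> U \<union> V" for v
    proof -
      \<comment> \<open>Only vertices of \<open>U\<close> have bars in both drawings; for the others
        one summand vanishes.\<close>
      consider "v \<in> U" | "v \<in> V1" "v \<notin> U \<union> W" | "v \<in> W" "v \<notin> U \<union> V1"
        using \<open>v \<in> U \<union> V\<close> V1 by blast
      then show ?thesis
      proof cases
        case 1
        with S(3) T(3) R(2)[of v] have *: "copies R v \<le> (if h = 0 then 0 else h div 2 + 3) + 2"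
          by (meson add_mono order_trans)
        show ?thesis
        proof (cases "h = 0")
          case True
          then show ?thesis using * h by simp
        next
          case False
          then have "4 * copies R v \<le> 2 * h + 20" using * by simp
          then show ?thesis using n h False by (simp add: min_def)
        qed
      next
        case 2
        then have "4 * copies R v \<le> m + 5"
          using S(2) R(2)[of v] copies_eq_0[OF T(1), of v] by fastforce
        then show ?thesis using n by (simp add: min_def)
      next
        case 3
        then have "4 * copies R v \<le> m + 16"
          using T(2) R(2)[of v] copies_eq_0[OF S(1), of v] by fastforce
        then show ?thesis using n3 by (simp add: min_def)
      qed
    qed
    with R(1) V1(1) show ?thesis by blast
  qed
  then obtain S where S: "drawing U V S" "\<forall>v\<in>U \<union> V. 4 * copies S v \<le> m + 4 * min 5 (n + 1)" by blast
  have "copies S v \<le> (m + 4 * min 5 (n + 1)) div 4" if "v \<in> U \<union> V" for v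
    using S(2) that by (simp add: less_eq_div_iff_mult_less_eq mult.commute)
  then show ?thesis using ub_le_drawing[OF UV(1,2,5) S(1)] by blast
qed

theorem theorem18:
  shows "(\<forall>(m::nat) (n::nat) (G :: ('a, 'b) pre_digraph).
            2 \<le> n \<longrightarrow> n \<le> m \<longrightarrow> K\<^bsub>m,n\<^esub> G \<longrightarrow>
            real (ub G) \<le> min (real_of_int \<lceil>real m / 4\<rceil> + 2 * real m / real n + 12)
                              (real m / 4 + real n + 1))
       \<and> (\<exists>h :: nat \<Rightarrow> real. h \<in> o[at_top](\<lambda>m. real m) \<and>
            (\<forall>(m::nat) (n::nat) (G :: ('a, 'b) pre_digraph).
               2 \<le> n \<longrightarrow> n \<le> m \<longrightarrow> K\<^bsub>m,n\<^esub> G \<longrightarrow>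
               real (ub G) \<le> real m / 4 + h m))"
proof -
  \<comment> \<open>One estimate serves both claims: 5 is below 12, and \<open>n + 1\<close> is the
    constant in the second term of the minimum.\<close>
  have bound: "real (ub G) \<le> real m / 4 + min 5 (real n + 1)"
    if "2 \<le> n" "n \<le> m" "K\<^bsub>m,n\<^esub> G" for m n and G :: "('a, 'b) pre_digraph"
  proof -
    have "4 * ub G \<le> m + 4 * min 5 (n + 1)"
      using ub_complete_bipartite_le[OF that] by linarith
    then have "real (4 * ub G) \<le> real (m + 4 * min 5 (n + 1))" by (simp only: of_nat_le_iff)
    then show ?thesis by (simp add: min_def split: if_splits)
  qed
  \<comment> \<open>The witness is the constant 5, which does not depend on \<open>n\<close>; this
    gives the uniformity.\<close>
  show ?thesis
  proof (intro conjI allI impI exI[of _ "\<lambda>_. 5"])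
    fix m n and G :: "('a, 'b) pre_digraph"
    assume *: "2 \<le> n" "n \<le> m" "K\<^bsub>m,n\<^esub> G"
    have "real m / 4 \<le> real_of_int \<lceil>real m / 4\<rceil>" "0 \<le> 2 * real m / real n" by simp_all
    moreover have "real (ub G) \<le> real m / 4 + 5" "real (ub G) \<le> real m / 4 + real n + 1"
      using bound[OF *] by simp_all
    ultimately show "real (ub G) \<le> min (real_of_int \<lceil>real m / 4\<rceil> + 2 * real m / real n + 12)
        (real m / 4 + real n + 1)" unfolding min.bounded_iff by linarith
    from bound[OF *] show "real (ub G) \<le> real m / 4 + 5" by simp
  next
    show "(\<lambda>_. 5) \<in> o[at_top](\<lambda>m. real m)"
      by (rule smalloI_tendsto[OF lim_const_over_n]) (auto intro: eventually_at_top_linorderI[of 1])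
  qed
qed

end
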